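(* Let $n\ge 3$ and let $U=U(C_n,\{T_{m_1},\dots,T_{m_k}\})$ be the signed unicyclic graph consisting of a signed cycle $C_n$ and $k$ pairwise vertex-disjoint signed trees $T_{m_1},\dots,T_{m_k}$ (with $m_i$ vertices), where the root of each $T_{m_i}$ is joined by an edge to the same fixed vertex $v$ of $C_n$. Then $$\det U=\det(C_n)\prod_{i=1}^k\det(T_{m_i})+\det(P_{n-1})\sum_{i=1}^k\Big(\det(\{T_{m_i},v\})\prod_{j=1,\,j\ne i}^k\det(T_{m_j})\Big).$$
   Context: A signed graph has edge weights in $\{1,-1\}$ and its determinant is the determinant of its adjacency matrix. $P_{n-1}$ denotes the signed path $C_n\setminus v$ on $n-1$ vertices, and $\{T_{m_i},v\}$ denotes the subgraph of $U$ induced by the vertices of $T_{m_i}$ together with $v$. *)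

theory Defs
  imports "Jordan_Normal_Form.Determinant"
begin

text \<open>
  A graph is given by its vertices, its edges (two-element sets of vertices) and a sign for
  each edge. Values of \<open>esign\<close> off the edge set are irrelevant.
\<close>

record 'a sgraph =
  gverts :: "'a set"
  gedges :: "'a set set"
  esign :: "'a set \<Rightarrow> int"

definition signed_graph :: "'a sgraph \<Rightarrow> bool" where
  "signed_graph G \<longleftrightarrow>
     finite (gverts G) \<and>
     (\<forall>e \<in> gedges G. \<exists>x \<in> gverts G. \<exists>y \<in> gverts G. x \<noteq> y \<and> e = {x, y}) \<and>
     (\<forall>e \<in> gedges G. esign G e \<in> {1, -1})"

definition adj :: "'a sgraph \<Rightarrow> 'a \<Rightarrow> 'a \<Rightarrow> int" where
  "adj G x y = (if {x, y} \<in> gedges G then esign G {x, y} else 0)"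

definition adjacency_matrix :: "'a sgraph \<Rightarrow> 'a list \<Rightarrow> int mat" where
  "adjacency_matrix G xs = mat (length xs) (length xs) (\<lambda>(i, j). adj G (xs ! i) (xs ! j))"

text \<open>
  The order in which the vertices are listed does not matter, see \<open>gdet_eq\<close> below.
\<close>

definition gdet :: "'a sgraph \<Rightarrow> int" where
  "gdet G = det (adjacency_matrix G (SOME xs. distinct xs \<and> set xs = gverts G))"

definition induced :: "'a sgraph \<Rightarrow> 'a set \<Rightarrow> 'a sgraph" where
  "induced G S = \<lparr>gverts = gverts G \<inter> S,
                  gedges = {e \<in> gedges G. e \<subseteq> S},
                  esign = esign G\<rparr>"

definition del_vertex :: "'a sgraph \<Rightarrow> 'a \<Rightarrow> 'a sgraph" where
  "del_vertex G v = induced G (gverts G - {v})"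

definition cycle_edges :: "nat \<Rightarrow> (nat \<Rightarrow> 'a) \<Rightarrow> 'a set set" where
  "cycle_edges n f = {{f i, f (Suc i mod n)} | i. i < n}"

definition signed_cycle :: "nat \<Rightarrow> 'a sgraph \<Rightarrow> bool" where
  "signed_cycle n G \<longleftrightarrow>
     signed_graph G \<and> n \<ge> 3 \<and>
     (\<exists>f. bij_betw f {..<n} (gverts G) \<and> gedges G = cycle_edges n f)"

definition connected_graph :: "'a sgraph \<Rightarrow> bool" where
  "connected_graph G \<longleftrightarrow>
     gverts G \<noteq> {} \<and>
     (\<forall>x \<in> gverts G. \<forall>y \<in> gverts G. (x, y) \<in> {(a, b). {a, b} \<in> gedges G}\<^sup>*)"

definition acyclic_graph :: "'a sgraph \<Rightarrow> bool" where
  "acyclic_graph G \<longleftrightarrow>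
     \<not> (\<exists>n f. n \<ge> 3 \<and> inj_on f {..<n} \<and> f ` {..<n} \<subseteq> gverts G \<and>
              cycle_edges n f \<subseteq> gedges G)"

definition signed_tree :: "nat \<Rightarrow> 'a sgraph \<Rightarrow> bool" where
  "signed_tree m G \<longleftrightarrow>
     signed_graph G \<and> card (gverts G) = m \<and> connected_graph G \<and> acyclic_graph G"

text \<open>
  \<open>U\<close> arises from the cycle \<open>C\<close> and the trees \<open>T 1, \<dots>, T k\<close> with roots \<open>r 1, \<dots>, r k\<close> by joining
  every root to the vertex \<open>v\<close> of \<open>C\<close>. The signs of the joining edges are arbitrary.
\<close>

definition signed_unicyclic ::
  "'a sgraph \<Rightarrow> nat \<Rightarrow> 'a sgraph \<Rightarrow> 'a \<Rightarrow> nat \<Rightarrow> (nat \<Rightarrow> nat) \<Rightarrow> (nat \<Rightarrow> 'a sgraph)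
     \<Rightarrow> (nat \<Rightarrow> 'a) \<Rightarrow> bool" where
  "signed_unicyclic U n C v k m T r \<longleftrightarrow>
     signed_graph U \<and>
     signed_cycle n C \<and> v \<in> gverts C \<and>
     (\<forall>i \<in> {1..k}. signed_tree (m i) (T i) \<and> r i \<in> gverts (T i)) \<and>
     (\<forall>i \<in> {1..k}. gverts (T i) \<inter> gverts C = {}) \<and>
     (\<forall>i \<in> {1..k}. \<forall>j \<in> {1..k}. i \<noteq> j \<longrightarrow> gverts (T i) \<inter> gverts (T j) = {}) \<and>
     gverts U = gverts C \<union> (\<Union>i \<in> {1..k}. gverts (T i)) \<and>
     gedges U = gedges C \<union> (\<Union>i \<in> {1..k}. gedges (T i)) \<union> (\<Union>i \<in> {1..k}. {{r i, v}}) \<and>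
     (\<forall>e \<in> gedges C. esign U e = esign C e) \<and>
     (\<forall>i \<in> {1..k}. \<forall>e \<in> gedges (T i). esign U e = esign (T i) e)"

lemma det_adjacency_matrix:
  assumes "distinct xs"
  shows "det (adjacency_matrix G xs) =
           (\<Sum>p | p permutes set xs. sign p * (\<Prod>x \<in> set xs. adj G x (p x)))"
proof -
  let ?A = "{0..<length xs}"
  let ?f = "\<lambda>i. xs ! i"
  have bij: "bij_betw ?f ?A (set xs)"
    using assms by (simp add: bij_betw_nth atLeast0LessThan)
  have inj: "inj_on ?f ?A" and im: "?f ` ?A = set xs"
    using bij by (auto simp: bij_betw_def)
  have lt: "p i < length xs" if "p permutes ?A" "i < length xs" for p i
    using permutes_in_image[OF that(1), of i] that(2) by simp
  have bp: "bij_betw (map_permutation ?A ?f) {p. p permutes ?A} {p. p permutes set xs}"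
    by (rule bij_betw_byWitness[where f' = "map_permutation (set xs) (inv_into ?A ?f)"])
       (use bij in \<open>auto intro!: map_permutation_permutes map_permutation_compose_inv
          bij_betw_inv_into simp: bij_betw_inv_into_left bij_betw_inv_into_right\<close>)
  have "(\<Sum>p | p permutes set xs. sign p * (\<Prod>x \<in> set xs. adj G x (p x))) =
        (\<Sum>p | p permutes ?A. sign (map_permutation ?A ?f p) *
           (\<Prod>x \<in> set xs. adj G x (map_permutation ?A ?f p x)))"
    by (rule sum.reindex_bij_betw[OF bp, symmetric])
  also have "\<dots> = (\<Sum>p | p permutes ?A. sign p * (\<Prod>i \<in> ?A. adj G (xs ! i) (xs ! p i)))"
  proof (rule sum.cong[OF refl])
    fix p assume "p \<in> {p. p permutes ?A}"
    then have p: "p permutes ?A" by simp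
    have "(\<Prod>x \<in> set xs. adj G x (map_permutation ?A ?f p x)) =
          (\<Prod>i \<in> ?A. adj G (xs ! i) (map_permutation ?A ?f p (xs ! i)))"
      by (rule prod.reindex_bij_betw[OF bij, symmetric])
    also have "\<dots> = (\<Prod>i \<in> ?A. adj G (xs ! i) (xs ! p i))"
      using map_permutation_apply[OF inj] by (intro prod.cong) auto
    finally show "sign (map_permutation ?A ?f p) *
        (\<Prod>x \<in> set xs. adj G x (map_permutation ?A ?f p x)) =
        sign p * (\<Prod>i \<in> ?A. adj G (xs ! i) (xs ! p i))"
      using sign_map_permutation[OF inj p] by simp
  qed
  also have "\<dots> = det (adjacency_matrix G xs)"
    unfolding adjacency_matrix_def det_def
    by (auto intro!: sum.cong prod.cong simp: lt)
  finally show ?thesis by simp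
qed

lemma gdet_eq:
  assumes "distinct xs" "set xs = gverts G"
  shows "gdet G = det (adjacency_matrix G xs)"
proof -
  let ?ys = "SOME xs. distinct xs \<and> set xs = gverts G"
  have "distinct ?ys \<and> set ?ys = gverts G"
    using assms by (intro someI[of "\<lambda>xs. distinct xs \<and> set xs = gverts G" xs]) auto
  then show ?thesis
    using assms by (simp add: gdet_def det_adjacency_matrix)
qed

end

theory Submission
  imports Defs
begin

text \<open>
  Every tree hangs off the cycle at the single vertex \<open>v\<close>, so it suffices to know how the
  determinant behaves when two graphs are glued at one vertex. Split the row of \<open>v\<close> into its part
  towards the first graph and its part towards the second. In each of the two summands the matrix
  is block triangular, whence
  \<open>det (A \<union> {v} \<union> B) = det (A \<union> {v}) det B + det A det ({v} \<union> B)\<close>.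
  Gluing the trees one after the other gives the formula.
\<close>

text \<open>Determinants are indexed by vertex sets, so that no vertex ordering has to be carried around.\<close>

definition set_det :: "('a \<Rightarrow> 'a \<Rightarrow> int) \<Rightarrow> 'a set \<Rightarrow> int" where
  "set_det a S = (\<Sum>p | p permutes S. sign p * (\<Prod>x\<in>S. a x (p x)))"

lemma set_det_cong:
  assumes "\<And>x y. x \<in> S \<Longrightarrow> y \<in> S \<Longrightarrow> a x y = b x y"
  shows "set_det a S = set_det b S"
  unfolding set_det_def
  by (intro sum.cong refl arg_cong2[of _ _ _ _ "(*)"] prod.cong)
     (auto intro!: assms simp: permutes_in_image)

lemma set_det_empty [simp]: "set_det a {} = 1"
  by (simp add: set_det_def)

lemma gdet_eq_set_det:
  assumes "finite (gverts G)"
  shows "gdet G = set_det (adj G) (gverts G)"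
proof -
  obtain xs where "set xs = gverts G" "distinct xs"
    using finite_distinct_list[OF assms] by blast
  then show ?thesis
    by (simp add: gdet_eq det_adjacency_matrix set_det_def)
qed

section \<open>Block triangular determinants\<close>

text \<open>An injection of the finite set \<open>A\<close> into itself is onto, so a permutation
  that keeps \<open>A\<close> inside \<open>A\<close> also maps \<open>B\<close> onto
  \<open>B\<close>. It is therefore determined by its two restrictions, which can be chosen
  independently.\<close>

lemma bij_betw_permutes_Un:
  assumes fin: "finite A" and disj: "A \<inter> B = {}"
  shows "bij_betw (\<lambda>(p, q). p \<circ> q) ({p. p permutes A} \<times> {q. q permutes B})
           {p. p permutes (A \<union> B) \<and> p ` A \<subseteq> A}"
\<comment> \<open>The inverse map restricts \<open>p\<close> to each of the two sets and extends by
  the identity, which makes each restriction a permutation of its own set.\<close>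
proof (rule bij_betw_byWitness[where f' =
      "\<lambda>p. (\<lambda>x. if x \<in> A then p x else x, \<lambda>x. if x \<in> B then p x else x)"])
  \<comment> \<open>On \<open>A\<close> the factor \<open>q\<close> is the identity. On
    \<open>B\<close>, \<open>q\<close> stays in \<open>B\<close>, hence outside \<open>A\<close>,
    where \<open>p\<close> is the identity.\<close>
  have compose_A: "(p \<circ> q) x = p x" if "p permutes A" "q permutes B" "x \<in> A" for p q x
    using that disj by (auto dest: permutes_not_in[of q B x])
  have compose_B: "(p \<circ> q) x = q x" if "p permutes A" "q permutes B" "x \<in> B" for p q x
  proof -
    have "q x \<notin> A"
      using that disj permutes_in_image[of q B x] by auto
    then show ?thesis
      using that by (simp add: permutes_not_in)
  qed
  show "\<forall>pq\<in>{p. p permutes A} \<times> {q. q permutes B}.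
      (\<lambda>p. (\<lambda>x. if x \<in> A then p x else x, \<lambda>x. if x \<in> B then p x else x))
        ((\<lambda>(p, q). p \<circ> q) pq) = pq"
    using compose_A compose_B by (auto simp: fun_eq_iff permutes_not_in)
  show "(\<lambda>(p, q). p \<circ> q) ` ({p. p permutes A} \<times> {q. q permutes B})
      \<subseteq> {p. p permutes (A \<union> B) \<and> p ` A \<subseteq> A}"
  proof clarsimp
    fix p q assume p: "p permutes A" and q: "q permutes B"
    have "p \<circ> q permutes (A \<union> B)"
      by (rule permutes_compose) (use p q permutes_subset in blast)+
    moreover have "p (q x) \<in> A" if "x \<in> A" for x
      using compose_A[OF p q that] that permutes_in_image[OF p, of x] by simp
    ultimately show "p \<circ> q permutes (A \<union> B) \<and> (\<lambda>x. p (q x)) ` A \<subseteq> A"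
      by auto
  qed
  have image: "p ` A = A \<and> p ` B = B" if p: "p permutes (A \<union> B)" "p ` A \<subseteq> A" for p
  proof -
    have inj: "inj p"
      using p(1) by (rule permutes_inj)
    have A: "p ` A = A"
      using p(2) fin inj by (intro endo_inj_surj) (auto intro: inj_on_subset)
    have "A \<union> p ` B = A \<union> B"
      using permutes_image[OF p(1)] A by (simp add: image_Un)
    moreover have "p ` A \<inter> p ` B = {}"
      using disj inj by (simp add: image_Int[symmetric])
    moreover have "X = B" if "A \<union> X = A \<union> B" "A \<inter> X = {}" for X
      using that disj by blast
    ultimately show ?thesis
      using A by simp
  qed
  have restrict: "(\<lambda>x. if x \<in> X then p x else x) permutes X"
    if p: "p permutes (A \<union> B)" and X: "p ` X = X" for p X
  proof (rule bij_imp_permutes)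
    have "bij_betw p X X"
      using permutes_inj[OF p] X by (auto simp: bij_betw_def intro: inj_on_subset)
    then show "bij_betw (\<lambda>x. if x \<in> X then p x else x) X X"
      by (simp cong: bij_betw_cong)
  qed simp
  show "(\<lambda>p. (\<lambda>x. if x \<in> A then p x else x, \<lambda>x. if x \<in> B then p x else x)) `
      {p. p permutes (A \<union> B) \<and> p ` A \<subseteq> A} \<subseteq> {p. p permutes A} \<times> {q. q permutes B}"
  proof (rule image_subsetI)
    fix p assume "p \<in> {p. p permutes (A \<union> B) \<and> p ` A \<subseteq> A}"
    then have "p permutes (A \<union> B)" "p ` A = A" "p ` B = B"
      using image[of p] by simp_all
    then show "(\<lambda>x. if x \<in> A then p x else x, \<lambda>x. if x \<in> B then p x else x)
        \<in> {p. p permutes A} \<times> {q. q permutes B}"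
      by (simp add: restrict)
  qed
  show "\<forall>p\<in>{p. p permutes (A \<union> B) \<and> p ` A \<subseteq> A}.
      (\<lambda>(p, q). p \<circ> q) (\<lambda>x. if x \<in> A then p x else x, \<lambda>x. if x \<in> B then p x else x) = p"
  proof
    fix p assume "p \<in> {p. p permutes (A \<union> B) \<and> p ` A \<subseteq> A}"
    then have p: "p permutes (A \<union> B)" and im: "p ` A = A" "p ` B = B"
      using image by auto
    show "(\<lambda>(p, q). p \<circ> q) (\<lambda>x. if x \<in> A then p x else x, \<lambda>x. if x \<in> B then p x else x) = p"
      using im disj permutes_not_in[OF p] by (auto simp: fun_eq_iff)
  qed
qed

text \<open>A permutation that sends some point of \<open>A\<close> into \<open>B\<close> picks up a
  zero factor there. The others are the pairs of permutations of \<open>A\<close> and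
  \<open>B\<close>, and both the sign and the product of entries factor over such a pair. Only the
  entries from \<open>A\<close> to \<open>B\<close> have to vanish, not those from \<open>B\<close>
  to \<open>A\<close>.\<close>

lemma set_det_block_triangular:
  assumes fin: "finite A" "finite B" and disj: "A \<inter> B = {}"
    and zero: "\<And>x y. x \<in> A \<Longrightarrow> y \<in> B \<Longrightarrow> a x y = 0"
  shows "set_det a (A \<union> B) = set_det a A * set_det a B"
proof -
  let ?t = "\<lambda>S p. sign p * (\<Prod>x\<in>S. a x (p x))"
  have "set_det a (A \<union> B) = (\<Sum>p | p permutes (A \<union> B) \<and> p ` A \<subseteq> A. ?t (A \<union> B) p)"
    unfolding set_det_def
  proof (rule sum.mono_neutral_right)
    show "finite {p. p permutes (A \<union> B)}"
      using fin by (simp add: finite_permutations)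
    show "\<forall>p\<in>{p. p permutes (A \<union> B)} - {p. p permutes (A \<union> B) \<and> p ` A \<subseteq> A}.
        ?t (A \<union> B) p = 0"
    proof
      fix p assume "p \<in> {p. p permutes (A \<union> B)} - {p. p permutes (A \<union> B) \<and> p ` A \<subseteq> A}"
      then obtain x where p: "p permutes (A \<union> B)" and x: "x \<in> A" "p x \<notin> A"
        by auto
      then have "a x (p x) = 0"
        using zero[of x "p x"] permutes_in_image[OF p, of x] by auto
      then show "?t (A \<union> B) p = 0"
        using x fin by (auto intro!: prod_zero)
    qed
  qed auto
  \<comment> \<open>The surviving permutations are reindexed by their restrictions to
    \<open>A\<close> and \<open>B\<close>.\<close>
  also have "\<dots> = (\<Sum>(p, q)\<in>{p. p permutes A} \<times> {q. q permutes B}. ?t (A \<union> B) (p \<circ> q))"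
    using sum.reindex_bij_betw[OF bij_betw_permutes_Un[OF fin(1) disj], of "?t (A \<union> B)"]
    by (simp add: case_prod_unfold)
  also have "\<dots> = (\<Sum>(p, q)\<in>{p. p permutes A} \<times> {q. q permutes B}. ?t A p * ?t B q)"
  proof (rule sum.cong[OF refl], clarsimp)
    fix p q assume p: "p permutes A" and q: "q permutes B"
    have "permutation p" "permutation q"
      using p q fin permutation_permutes by blast+
    then have "sign (p \<circ> q) = sign p * sign q"
      by (rule sign_compose)
    moreover have "q x = x" if "x \<in> A" for x
      using that disj by (intro permutes_not_in[OF q]) auto
    then have "(\<Prod>x\<in>A. a x (p (q x))) = (\<Prod>x\<in>A. a x (p x))"
      by simp
    moreover have "p (q x) = q x" if "x \<in> B" for x
      using that disj permutes_in_image[OF q, of x] by (intro permutes_not_in[OF p]) auto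
    then have "(\<Prod>x\<in>B. a x (p (q x))) = (\<Prod>x\<in>B. a x (q x))"
      by simp
    ultimately show "sign (p \<circ> q) * (\<Prod>x\<in>A \<union> B. a x (p (q x))) = ?t A p * ?t B q"
      using fin disj by (simp add: prod.union_disjoint)
  qed
  also have "\<dots> = set_det a A * set_det a B"
    unfolding set_det_def by (simp add: sum_product sum.cartesian_product)
  finally show ?thesis .
qed

text \<open>Once \<open>v\<close> is removed, the trees are mutually non-adjacent. They are split
  off one at a time as diagonal blocks.\<close>

lemma set_det_UNION:
  assumes "finite I" "\<And>i. i \<in> I \<Longrightarrow> finite (B i)"
    and "\<And>i j. i \<in> I \<Longrightarrow> j \<in> I \<Longrightarrow> i \<noteq> j \<Longrightarrow> B i \<inter> B j = {}"
    and "\<And>i j x y. i \<in> I \<Longrightarrow> j \<in> I \<Longrightarrow> i \<noteq> j \<Longrightarrow> x \<in> B i \<Longrightarrow> y \<in> B j \<Longrightarrow> a x y = 0"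
  shows "set_det a (\<Union>i\<in>I. B i) = (\<Prod>i\<in>I. set_det a (B i))"
  using assms
proof (induction I rule: finite_induct)
  case (insert i I)
  have "set_det a (\<Union>j\<in>I. B j) = (\<Prod>j\<in>I. set_det a (B j))"
    by (rule insert.IH) ((rule insert.prems; ((rule insertI2)?, assumption))+)
  moreover have "set_det a (B i \<union> (\<Union>j\<in>I. B j)) = set_det a (B i) * set_det a (\<Union>j\<in>I. B j)"
  proof (rule set_det_block_triangular)
    show "B i \<inter> (\<Union>j\<in>I. B j) = {}"
      using insert.hyps insert.prems(2)[of i] by auto
    show "a x y = 0" if "x \<in> B i" "y \<in> (\<Union>j\<in>I. B j)" for x y
      using that insert.hyps insert.prems(3)[of i] by auto
  qed (use insert in auto)
  ultimately show ?case
    using insert.hyps by simp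
qed simp

section \<open>Gluing at a single vertex\<close>

text \<open>Additivity of the determinant in one row: each term of the expansion contains exactly
  one factor from row \<open>v\<close>.\<close>

lemma set_det_row_add:
  assumes "finite S" "v \<in> S"
    and "\<And>y. y \<in> S \<Longrightarrow> a v y = b v y + c v y"
    and "\<And>x y. x \<in> S \<Longrightarrow> x \<noteq> v \<Longrightarrow> y \<in> S \<Longrightarrow> b x y = a x y"
    and "\<And>x y. x \<in> S \<Longrightarrow> x \<noteq> v \<Longrightarrow> y \<in> S \<Longrightarrow> c x y = a x y"
  shows "set_det a S = set_det b S + set_det c S"
  unfolding set_det_def sum.distrib[symmetric]
proof (rule sum.cong[OF refl])
  fix p assume "p \<in> {p. p permutes S}"
  then have p: "p permutes S" by simp
  have "(\<Prod>x\<in>S - {v}. b x (p x)) = (\<Prod>x\<in>S - {v}. a x (p x))"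
    "(\<Prod>x\<in>S - {v}. c x (p x)) = (\<Prod>x\<in>S - {v}. a x (p x))"
    using assms(4,5) permutes_in_image[OF p] by (auto intro!: prod.cong)
  moreover have "a v (p v) = b v (p v) + c v (p v)"
    using assms(2,3) permutes_in_image[OF p] by auto
  ultimately show "sign p * (\<Prod>x\<in>S. a x (p x)) =
      sign p * (\<Prod>x\<in>S. b x (p x)) + sign p * (\<Prod>x\<in>S. c x (p x))"
    by (simp add: prod.remove[OF assms(1,2)] algebra_simps)
qed

text \<open>Only the row of \<open>v\<close> is split; its column stays intact. This is why the two
  matrices are in general block triangular and not block diagonal.\<close>

lemma set_det_coalescence:
  assumes fin: "finite A" "finite B" and disj: "A \<inter> B = {}" "v \<notin> A" "v \<notin> B"
    and loop: "a v v = 0"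
    and zero: "\<And>x y. x \<in> A \<Longrightarrow> y \<in> B \<Longrightarrow> a x y = 0" "\<And>x y. x \<in> B \<Longrightarrow> y \<in> A \<Longrightarrow> a x y = 0"
  shows "set_det a (insert v (A \<union> B)) =
    set_det a (insert v A) * set_det a B + set_det a A * set_det a (insert v B)"
proof -
  \<comment> \<open>\<open>b\<close> keeps the row of \<open>v\<close> towards \<open>A\<close> and
    the diagonal entry, \<open>c\<close> keeps it towards \<open>B\<close>.\<close>
  define b where "b x y = (if x = v \<and> y \<in> B then 0 else a x y)" for x y
  define c where "c x y = (if x = v \<and> y \<notin> B then 0 else a x y)" for x y
  have "set_det a (insert v (A \<union> B)) = set_det b (insert v (A \<union> B)) + set_det c (insert v (A \<union> B))"
    by (rule set_det_row_add[of _ v]) (use fin in \<open>auto simp: b_def c_def\<close>)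
  moreover have "set_det b (insert v A \<union> B) = set_det b (insert v A) * set_det b B"
    by (rule set_det_block_triangular) (use assms in \<open>auto simp: b_def\<close>)
  moreover have "set_det b (insert v A) = set_det a (insert v A)" "set_det b B = set_det a B"
    using disj by (auto intro!: set_det_cong simp: b_def)
  \<comment> \<open>For \<open>c\<close> the roles are exchanged: \<open>v\<close> now belongs to
    the block of \<open>B\<close>, and no entry leads from this block to \<open>A\<close>.\<close>
  moreover have "set_det c (insert v B \<union> A) = set_det c (insert v B) * set_det c A"
    by (rule set_det_block_triangular) (use assms in \<open>auto simp: c_def\<close>)
  \<comment> \<open>The diagonal entry of \<open>c\<close> at \<open>v\<close> is 0 since
    \<open>v\<close> lies outside \<open>B\<close>; it agrees with that of \<open>a\<close> because
    there is no loop at \<open>v\<close>.\<close>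
  moreover have "set_det c (insert v B) = set_det a (insert v B)" "set_det c A = set_det a A"
    using disj loop by (auto intro!: set_det_cong simp: c_def)
  ultimately show ?thesis
    by (simp add: Un_commute mult.commute)
qed

text \<open>Induction on the set of branches: everything glued so far is the first graph and the new
  branch the second. The sum grows like a product rule, since each summand has exactly one branch
  that retains \<open>v\<close>.\<close>

lemma set_det_coalescence_UNION:
  assumes "finite I" "finite A" "v \<notin> A" "a v v = 0"
    and "\<And>i. i \<in> I \<Longrightarrow> finite (B i)" "\<And>i. i \<in> I \<Longrightarrow> v \<notin> B i" "\<And>i. i \<in> I \<Longrightarrow> A \<inter> B i = {}"
    and "\<And>i j. i \<in> I \<Longrightarrow> j \<in> I \<Longrightarrow> i \<noteq> j \<Longrightarrow> B i \<inter> B j = {}"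
    and "\<And>i x y. i \<in> I \<Longrightarrow> x \<in> A \<Longrightarrow> y \<in> B i \<Longrightarrow> a x y = 0"
    and "\<And>i x y. i \<in> I \<Longrightarrow> x \<in> B i \<Longrightarrow> y \<in> A \<Longrightarrow> a x y = 0"
    and "\<And>i j x y. i \<in> I \<Longrightarrow> j \<in> I \<Longrightarrow> i \<noteq> j \<Longrightarrow> x \<in> B i \<Longrightarrow> y \<in> B j \<Longrightarrow> a x y = 0"
  shows "set_det a (insert v (A \<union> (\<Union>i\<in>I. B i))) =
    set_det a (insert v A) * (\<Prod>i\<in>I. set_det a (B i)) +
    set_det a A * (\<Sum>i\<in>I. set_det a (insert v (B i)) * (\<Prod>j\<in>I - {i}. set_det a (B j)))"
  using assms
proof (induction I rule: finite_induct)
  case (insert i I)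
  let ?d = "\<lambda>j. set_det a (B j)" and ?e = "\<lambda>j. set_det a (insert v (B j))"
  let ?A = "A \<union> (\<Union>j\<in>I. B j)"
  have neq: "i \<noteq> j" if "j \<in> I" for j
    using that insert.hyps by auto
  have IH: "set_det a (insert v ?A) = set_det a (insert v A) * (\<Prod>j\<in>I. ?d j) +
      set_det a A * (\<Sum>j\<in>I. ?e j * (\<Prod>l\<in>I - {j}. ?d l))"
    by (rule insert.IH[OF insert.prems(1-3)])
       ((rule insert.prems; ((rule insertI2)?, assumption))+)
  have "set_det a (insert v (?A \<union> B i)) =
      set_det a (insert v ?A) * ?d i + set_det a ?A * ?e i"
  proof (rule set_det_coalescence)
    show "?A \<inter> B i = {}"
      using neq insert.prems(6)[of i] insert.prems(7)[of i] by auto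
    show "a x y = 0" if "x \<in> ?A" "y \<in> B i" for x y
      using that neq insert.prems(8)[of i x y] insert.prems(10)[of _ i x y] by auto
    show "a x y = 0" if "x \<in> B i" "y \<in> ?A" for x y
      using that neq insert.prems(9)[of i x y] insert.prems(10)[of i _ x y] by auto
  qed (use insert.hyps(1) insert.prems(1-5) in auto)
  \<comment> \<open>Without \<open>v\<close>, what has been glued so far falls apart into
    \<open>A\<close> and the old branches, so its determinant is a product.\<close>
  moreover have "set_det a ?A = set_det a A * (\<Prod>j\<in>I. ?d j)"
  proof -
    have "set_det a (\<Union>j\<in>I. B j) = (\<Prod>j\<in>I. ?d j)"
      by (rule set_det_UNION[OF insert.hyps(1)])
         ((rule insert.prems; ((rule insertI2)?, assumption))+)
    moreover have "set_det a ?A = set_det a A * set_det a (\<Union>j\<in>I. B j)"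
    proof (rule set_det_block_triangular)
      show "finite (\<Union>j\<in>I. B j)"
        using insert.hyps(1) insert.prems(4) by auto
      show "A \<inter> (\<Union>j\<in>I. B j) = {}"
        using insert.prems(6) by auto
      show "a x y = 0" if "x \<in> A" "y \<in> (\<Union>j\<in>I. B j)" for x y
        using that insert.prems(8)[of _ x y] by auto
    qed (rule insert.prems(1))
    ultimately show ?thesis by simp
  qed
  moreover have "insert v (A \<union> (\<Union>j\<in>insert i I. B j)) = insert v (?A \<union> B i)"
    by auto
  \<comment> \<open>In every old summand the new branch occurs without \<open>v\<close>, so it
    contributes the common factor \<open>?d i\<close>.\<close>
  moreover have "(\<Sum>j\<in>I. ?e j * (\<Prod>l\<in>insert i I - {j}. ?d l)) =
      (\<Sum>j\<in>I. ?e j * (\<Prod>l\<in>I - {j}. ?d l)) * ?d i"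
    unfolding sum_distrib_right
  proof (rule sum.cong[OF refl])
    fix j assume "j \<in> I"
    then have "insert i I - {j} = insert i (I - {j})"
      using neq by auto
    then show "?e j * (\<Prod>l\<in>insert i I - {j}. ?d l) = ?e j * (\<Prod>l\<in>I - {j}. ?d l) * ?d i"
      using insert.hyps by simp
  qed
  moreover have "insert i I - {i} = I"
    using insert.hyps by auto
  ultimately show ?case
    using insert.hyps IH by (simp add: algebra_simps)
qed simp

section \<open>From signed graphs to determinants over vertex sets\<close>

lemma edge_in_gverts:
  assumes "signed_graph G" "{x, y} \<in> gedges G"
  shows "x \<in> gverts G" "y \<in> gverts G" "x \<noteq> y"
proof -
  obtain p q where "p \<in> gverts G" "q \<in> gverts G" "p \<noteq> q" "{x, y} = {p, q}"
    using assms unfolding signed_graph_def by metis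
  then show "x \<in> gverts G" "y \<in> gverts G" "x \<noteq> y"
    by (auto simp: doubleton_eq_iff)
qed

lemma adj_induced: "x \<in> S \<Longrightarrow> y \<in> S \<Longrightarrow> adj (induced G S) x y = adj G x y"
  by (simp add: adj_def induced_def)

lemma gdet_induced:
  assumes "finite (gverts G)" "S \<subseteq> gverts G"
  shows "gdet (induced G S) = set_det (adj G) S"
proof -
  have "gverts (induced G S) = S"
    using assms(2) by (auto simp: induced_def)
  moreover have "set_det (adj (induced G S)) S = set_det (adj G) S"
    by (rule set_det_cong) (rule adj_induced)
  ultimately show ?thesis
    using assms gdet_eq_set_det[of "induced G S"] finite_subset by metis
qed

theorem theorem9:
  fixes U C :: "'a sgraph" and T :: "nat \<Rightarrow> 'a sgraph"
    and v :: 'a and r :: "nat \<Rightarrow> 'a" and n k :: nat and m :: "nat \<Rightarrow> nat"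
  assumes "n \<ge> 3"
    and "signed_unicyclic U n C v k m T r"
  shows "gdet U =
    gdet C * (\<Prod>i\<in>{1..k}. gdet (T i)) +
    gdet (del_vertex C v) *
      (\<Sum>i\<in>{1..k}. gdet (induced U (insert v (gverts (T i)))) *
         (\<Prod>j\<in>{1..k} - {i}. gdet (T j)))"
proof -
  \<comment> \<open>The path \<open>?A\<close> is the part of the cycle away from \<open>v\<close>;
    the trees \<open>?B i\<close> are the branches glued to it at \<open>v\<close>.\<close>
  let ?I = "{1..k}" and ?A = "gverts C - {v}" and ?B = "\<lambda>i. gverts (T i)" and ?a = "adj U"
  have U: "signed_graph U" and "signed_cycle n C" and v: "v \<in> gverts C"
    and trees: "\<And>i. i \<in> ?I \<Longrightarrow> signed_tree (m i) (T i)" and r: "\<And>i. i \<in> ?I \<Longrightarrow> r i \<in> ?B i"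
    and disj_C: "\<And>i. i \<in> ?I \<Longrightarrow> ?B i \<inter> gverts C = {}"
    and disj: "\<And>i j. i \<in> ?I \<Longrightarrow> j \<in> ?I \<Longrightarrow> i \<noteq> j \<Longrightarrow> ?B i \<inter> ?B j = {}"
    and verts: "gverts U = gverts C \<union> (\<Union>i\<in>?I. ?B i)"
    and edges: "gedges U = gedges C \<union> (\<Union>i\<in>?I. gedges (T i)) \<union> (\<Union>i\<in>?I. {{r i, v}})"
    and sign_C: "\<And>e. e \<in> gedges C \<Longrightarrow> esign U e = esign C e"
    and sign_T: "\<And>i e. i \<in> ?I \<Longrightarrow> e \<in> gedges (T i) \<Longrightarrow> esign U e = esign (T i) e"
    using assms(2) unfolding signed_unicyclic_def by simp_all
  then have C: "signed_graph C" and T: "\<And>i. i \<in> ?I \<Longrightarrow> signed_graph (T i)"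
    by (simp_all add: signed_cycle_def signed_tree_def)
  have fin_U: "finite (gverts U)" and fin_C: "finite (gverts C)"
    and fin_T: "\<And>i. i \<in> ?I \<Longrightarrow> finite (?B i)"
    using U C T unfolding signed_graph_def by blast+
  \<comment> \<open>All adjacency facts below follow from this classification of edges. The last
    case names both orders because \<open>{x, y}\<close> does not determine which endpoint is the
    root.\<close>
  have edge_cases: "(x \<in> gverts C \<and> y \<in> gverts C \<and> {x, y} \<in> gedges C) \<or>
      (\<exists>i\<in>?I. x \<in> ?B i \<and> y \<in> ?B i \<and> {x, y} \<in> gedges (T i)) \<or>
      (\<exists>i\<in>?I. x = r i \<and> y = v \<or> x = v \<and> y = r i)"
    if "{x, y} \<in> gedges U" for x y
  proof -
    from that consider "{x, y} \<in> gedges C" | i where "i \<in> ?I" "{x, y} \<in> gedges (T i)"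
      | i where "i \<in> ?I" "{x, y} = {r i, v}"
      unfolding edges by blast
    then show ?thesis
    proof cases
      case 1
      then show ?thesis
        using edge_in_gverts[OF C 1] by blast
    next
      case 2
      then show ?thesis
        using edge_in_gverts[OF T 2(2)] by blast
    next
      case 3
      then show ?thesis
        unfolding doubleton_eq_iff by blast
    qed
  qed
  have adj_C: "?a x y = adj C x y" if xy: "x \<in> gverts C" "y \<in> gverts C" for x y
  proof -
    have "{x, y} \<in> gedges U \<longleftrightarrow> {x, y} \<in> gedges C"
      using edge_cases[of x y] xy disj_C r edges by blast
    then show ?thesis
      by (simp add: adj_def sign_C)
  qed
  have adj_T: "?a x y = adj (T i) x y" if i: "i \<in> ?I" and xy: "x \<in> ?B i" "y \<in> ?B i" for i x y
  proof -
    have "{x, y} \<in> gedges U \<longleftrightarrow> {x, y} \<in> gedges (T i)"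
    proof
      assume "{x, y} \<in> gedges U"
      then show "{x, y} \<in> gedges (T i)"
        using edge_cases[of x y] i xy disj_C v disj by (metis disjoint_iff)
    qed (use i edges in blast)
    then show ?thesis
      using i by (simp add: adj_def sign_T)
  qed
  \<comment> \<open>An edge inside the cycle or inside one tree cannot connect the two, and a
    joining edge has \<open>v\<close> as an endpoint, which lies neither in \<open>?A\<close> nor in
    \<open>?B i\<close>.\<close>
  have adj_AB: "?a x y = 0" "?a y x = 0" if "i \<in> ?I" "x \<in> ?A" "y \<in> ?B i" for i x y
  proof -
    have "{x, y} \<notin> gedges U"
      using edge_cases[of x y] that disj_C v r by blast
    then show "?a x y = 0" "?a y x = 0"
      by (simp_all add: adj_def insert_commute)
  qed
  have adj_BB: "?a x y = 0" if "i \<in> ?I" "j \<in> ?I" "i \<noteq> j" "x \<in> ?B i" "y \<in> ?B j" for i j x y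
  proof -
    have "{x, y} \<notin> gedges U"
      using edge_cases[of x y] that disj_C v disj by (metis disjoint_iff)
    then show ?thesis
      by (simp add: adj_def)
  qed
  have loop: "?a v v = 0"
    using edge_in_gverts(3)[OF U, of v v] by (auto simp: adj_def)
  have det_C: "set_det ?a (insert v ?A) = gdet C"
    unfolding insert_Diff[OF v] gdet_eq_set_det[OF fin_C] by (rule set_det_cong) (rule adj_C)
  have "set_det ?a ?A = set_det (adj C) ?A"
    by (rule set_det_cong) (simp add: adj_C)
  then have det_P: "set_det ?a ?A = gdet (del_vertex C v)"
    using gdet_induced[OF fin_C, of ?A] by (simp add: del_vertex_def)
  have det_T: "set_det ?a (?B i) = gdet (T i)" if "i \<in> ?I" for i
    unfolding gdet_eq_set_det[OF fin_T[OF that]] by (rule set_det_cong) (rule adj_T[OF that])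
  \<comment> \<open>This subgraph is induced in \<open>U\<close> itself, so its entries are already
    those of \<open>?a\<close>, including the sign of the edge from \<open>r i\<close> to
    \<open>v\<close>.\<close>
  have det_Tv: "set_det ?a (insert v (?B i)) = gdet (induced U (insert v (?B i)))" if "i \<in> ?I" for i
    using that verts v by (intro gdet_induced[OF fin_U, symmetric]) auto
  have "gverts U = insert v (?A \<union> (\<Union>i\<in>?I. ?B i))"
    using verts v by auto
  then have "gdet U = set_det ?a (insert v (?A \<union> (\<Union>i\<in>?I. ?B i)))"
    using gdet_eq_set_det[OF fin_U] by simp
  also have "\<dots> = set_det ?a (insert v ?A) * (\<Prod>i\<in>?I. set_det ?a (?B i)) +
      set_det ?a ?A * (\<Sum>i\<in>?I. set_det ?a (insert v (?B i)) * (\<Prod>j\<in>?I - {i}. set_det ?a (?B j)))"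
  proof (rule set_det_coalescence_UNION)
    show "v \<notin> ?B i" "?A \<inter> ?B i = {}" if "i \<in> ?I" for i
      using disj_C[OF that] v by auto
  qed ((simp add: fin_C loop; fail | rule fin_T disj adj_AB adj_BB; assumption)+)
  also have "\<dots> = gdet C * (\<Prod>i\<in>?I. gdet (T i)) + gdet (del_vertex C v) *
      (\<Sum>i\<in>?I. gdet (induced U (insert v (?B i))) * (\<Prod>j\<in>?I - {i}. gdet (T j)))"
    unfolding det_C det_P by (simp add: det_T det_Tv)
  finally show ?thesis .
qed

end
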